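(* Let $v\in\mathbb{N}$, let $s\geq 1$ be a real number, let $(E,\rho)$ be a nonempty complete $b_v(s)$ metric space, and let $S:E\to E$ be a weakly contractive mapping, i.e. there is a nondecreasing and continuous function $\varphi:[0,\infty)\to[0,\infty)$ with $\varphi(t)=0$ if and only if $t=0$, such that $$\rho(Su,Sw)\leq \rho(u,w)-\varphi(\rho(u,w))\quad\text{for all } u,w\in E.$$ Then $S$ has a unique fixed point, i.e. there is exactly one $u\in E$ with $Su=u$.
   Context: $\mathbb{N}$ denotes the set of positive integers. Let $E$ be a set, $\rho:E\times E\to[0,\infty)$ a function, $v\in\mathbb{N}$ and $s\geq 1$ a real number. $(E,\rho)$ is a $b_v(s)$ metric space if for all $u,w\in E$ and for all distinct points $z_1,z_2,\dots,z_v\in E$, each of them different from $u$ and $w$: (1) $\rho(u,w)=0$ if and only if $u=w$; (2) $\rho(u,w)=\rho(w,u)$; (3) $\rho(u,w)\leq s[\rho(u,z_1)+\rho(z_1,z_2)+\cdots+\rho(z_v,w)]$. A sequence $\{u_n\}$ in $E$ converges to $u\in E$ if $\rho(u_n,u)\to 0$ as $n\to\infty$; it is Cauchy if for every $\varepsilon>0$ there is $n_0$ such that $\rho(u_n,u_{n+p})<\varepsilon$ for all $n>n_0$ and all $p\in\mathbb{N}$; $(E,\rho)$ is complete if every Cauchy sequence in $E$ converges to some point of $E$. *)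

theory Defs
  imports Complex_Main "HOL-Library.FuncSet"
begin

text \<open>
  The identity and symmetry axioms hold for all pairs of points, irrespective of whether \<open>v\<close> distinct
  intermediate points exist; only the polygonal inequality refers to intermediate points.
\<close>

locale bv_metric_space =
  fixes E :: "'a set" and \<rho> :: "'a \<Rightarrow> 'a \<Rightarrow> real" and v :: nat and s :: real
  assumes v_pos: "1 \<le> v"
    and s_ge_1: "1 \<le> s"
    and nonneg: "\<lbrakk>u \<in> E; w \<in> E\<rbrakk> \<Longrightarrow> 0 \<le> \<rho> u w"
    and zero_iff: "\<lbrakk>u \<in> E; w \<in> E\<rbrakk> \<Longrightarrow> \<rho> u w = 0 \<longleftrightarrow> u = w"
    and sym: "\<lbrakk>u \<in> E; w \<in> E\<rbrakk> \<Longrightarrow> \<rho> u w = \<rho> w u"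
    and polygon: "\<lbrakk>u \<in> E; w \<in> E; inj_on z {1..v}; z ` {1..v} \<subseteq> E - {u, w}\<rbrakk> \<Longrightarrow>
      \<rho> u w \<le> s * (\<rho> u (z 1) + (\<Sum>i = 1..<v. \<rho> (z i) (z (Suc i))) + \<rho> (z v) w)"
begin

definition converges_to :: "(nat \<Rightarrow> 'a) \<Rightarrow> 'a \<Rightarrow> bool" where
  "converges_to x u \<longleftrightarrow> (\<lambda>n. \<rho> (x n) u) \<longlonglongrightarrow> 0"

definition cauchy_seq :: "(nat \<Rightarrow> 'a) \<Rightarrow> bool" where
  "cauchy_seq x \<longleftrightarrow> (\<forall>\<epsilon>>0. \<exists>n0. \<forall>n>n0. \<forall>p\<ge>1. \<rho> (x n) (x (n + p)) < \<epsilon>)"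

end

locale complete_bv_metric_space = bv_metric_space +
  assumes complete: "\<lbrakk>range x \<subseteq> E; cauchy_seq x\<rbrakk> \<Longrightarrow> \<exists>u\<in>E. converges_to x u"

definition weakly_contractive :: "'a set \<Rightarrow> ('a \<Rightarrow> 'a \<Rightarrow> real) \<Rightarrow> ('a \<Rightarrow> 'a) \<Rightarrow> bool" where
  "weakly_contractive E \<rho> S \<longleftrightarrow>
     (\<exists>\<phi> :: real \<Rightarrow> real.
        \<phi> \<in> {0..} \<rightarrow> {0..} \<and> mono_on {0..} \<phi> \<and> continuous_on {0..} \<phi> \<and>
        (\<forall>t\<ge>0. \<phi> t = 0 \<longleftrightarrow> t = 0) \<and>
        (\<forall>u\<in>E. \<forall>w\<in>E. \<rho> (S u) (S w) \<le> \<rho> u w - \<phi> (\<rho> u w)))"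

end

theory Submission
  imports Defs
begin

text \<open>
  Since \<open>\<phi>\<close> is nondecreasing, each application of \<open>S\<close> shortens every distance exceeding \<open>\<delta>\<close> by at least
  \<open>\<phi> \<delta> > 0\<close>; hence for given \<open>K\<close> and \<open>\<delta>\<close> a single power \<open>S\<^sup>m\<close> brings all pairs at distance at most \<open>K\<close>
  to distance at most \<open>\<delta>\<close>. Let \<open>x\<^sub>n\<close> be a Picard sequence; unless \<open>S\<close> has a fixed point its consecutive
  distances strictly decrease, so its points are distinct. To see that it is Cauchy, choose \<open>m\<close> such
  that \<open>S\<^sup>m\<close> sends distance \<open>\<epsilon>\<close> to \<open>\<epsilon> / (2s)\<close>, and \<open>n\<close> so large that \<open>x\<^sub>n\<close>, \<open>x\<^bsub>n+m\<^esub>\<close> and the \<open>v - 1\<close> points after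
  it are close to each other. If \<open>\<rho> x\<^sub>n x\<^bsub>n+p\<^esub> \<le> \<epsilon>\<close> then \<open>\<rho> x\<^bsub>n+m\<^esub> x\<^bsub>n+m+p\<^esub> \<le> \<epsilon> / (2s)\<close>, and the polygonal
  inequality gives \<open>\<rho> x\<^sub>n x\<^bsub>n+m+p\<^esub> \<le> \<epsilon>\<close>, so the bound propagates to all \<open>p\<close>. A polygon through late points
  of the sequence shows that the limit is fixed.
\<close>

locale weak_contraction = bv_metric_space +
  fixes S :: "'a \<Rightarrow> 'a" and \<phi> :: "real \<Rightarrow> real"
  assumes maps_to: "u \<in> E \<Longrightarrow> S u \<in> E"
    and gauge_nonneg: "0 \<le> t \<Longrightarrow> 0 \<le> \<phi> t"
    and gauge_mono: "mono_on {0..} \<phi>"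
    and gauge_zero_iff: "0 \<le> t \<Longrightarrow> \<phi> t = 0 \<longleftrightarrow> t = 0"
    and contractive: "\<lbrakk>u \<in> E; w \<in> E\<rbrakk> \<Longrightarrow> \<rho> (S u) (S w) \<le> \<rho> u w - \<phi> (\<rho> u w)"
begin

lemma gauge_pos: "0 < t \<Longrightarrow> 0 < \<phi> t"
  using gauge_nonneg[of t] gauge_zero_iff[of t] by linarith

lemma funpow_maps_to: "u \<in> E \<Longrightarrow> (S ^^ n) u \<in> E"
  by (induction n) (auto intro: maps_to)

lemma nonexpansive: "\<lbrakk>u \<in> E; w \<in> E\<rbrakk> \<Longrightarrow> \<rho> (S u) (S w) \<le> \<rho> u w"
  using contractive[of u w] gauge_nonneg[OF nonneg, of u w] by linarith

lemma strictly_contractive: "\<lbrakk>u \<in> E; w \<in> E; u \<noteq> w\<rbrakk> \<Longrightarrow> \<rho> (S u) (S w) < \<rho> u w"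
  using contractive[of u w] gauge_pos[of "\<rho> u w"] nonneg[of u w] zero_iff[of u w] by fastforce

lemma fixed_point_unique: "\<lbrakk>u \<in> E; w \<in> E; S u = u; S w = w\<rbrakk> \<Longrightarrow> u = w"
  using strictly_contractive[of u w] by auto

text \<open>Above \<delta>, monotonicity of \<phi> makes every step lose at least
  \<open>\<phi> \<delta>\<close>; once at most \<delta>, the distance stays so by
  nonexpansiveness.\<close>

lemma funpow_dist_le:
  assumes "u \<in> E" "w \<in> E" "0 < \<delta>"
  shows "\<rho> ((S ^^ n) u) ((S ^^ n) w) \<le> max \<delta> (\<rho> u w - real n * \<phi> \<delta>)"
proof (induction n)
  case (Suc n)
  let ?t = "\<rho> ((S ^^ n) u) ((S ^^ n) w)"
  have E: "(S ^^ n) u \<in> E" "(S ^^ n) w \<in> E"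
    using assms funpow_maps_to by auto
  show ?case
  proof (cases "?t \<le> \<delta>")
    case True
    then show ?thesis using nonexpansive[OF E] by simp
  next
    case False
    then have "\<phi> \<delta> \<le> \<phi> ?t"
      using gauge_mono assms(3) by (auto intro: mono_onD)
    then show ?thesis using contractive[OF E] Suc False by (simp add: algebra_simps)
  qed
qed simp

text \<open>The exponent depends only on \<open>K\<close> and \<delta>, not on the pair, so
  \<open>picard_cauchy\<close> can fix it before \<open>p\<close> varies.\<close>

lemma funpow_uniformly_contracts:
  assumes "0 < \<delta>"
  obtains m where "\<And>u w n. \<lbrakk>u \<in> E; w \<in> E; \<rho> u w \<le> K; m \<le> n\<rbrakk> \<Longrightarrow> \<rho> ((S ^^ n) u) ((S ^^ n) w) \<le> \<delta>"
proof -
  obtain m where m: "K < real m * \<phi> \<delta>"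
    using reals_Archimedean3[OF gauge_pos[OF assms]] by blast
  show thesis
  proof
    fix u w n assume *: "u \<in> E" "w \<in> E" "\<rho> u w \<le> K" "m \<le> n"
    then have "real m * \<phi> \<delta> \<le> real n * \<phi> \<delta>"
      using gauge_pos[OF assms] by simp
    with * m assms funpow_dist_le[OF *(1,2) assms, of n]
    show "\<rho> ((S ^^ n) u) ((S ^^ n) w) \<le> \<delta>" by linarith
  qed
qed

lemma picard_dist_tendsto_0:
  assumes "a \<in> E"
  shows "(\<lambda>n. \<rho> ((S ^^ n) a) ((S ^^ (n + k)) a)) \<longlonglongrightarrow> 0"
proof (rule LIMSEQ_I)
  fix r :: real assume "0 < r"
  then have "0 < r / 2" by simp
  then obtain m where m: "\<And>u w n. \<lbrakk>u \<in> E; w \<in> E; \<rho> u w \<le> \<rho> a ((S ^^ k) a); m \<le> n\<rbrakk>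
      \<Longrightarrow> \<rho> ((S ^^ n) u) ((S ^^ n) w) \<le> r / 2"
    using funpow_uniformly_contracts by metis
  have "\<rho> ((S ^^ n) a) ((S ^^ (n + k)) a) \<le> r / 2" if "m \<le> n" for n
    using m[of a "(S ^^ k) a" n] assms that funpow_maps_to by (simp add: funpow_add)
  then show "\<exists>no. \<forall>n\<ge>no. norm (\<rho> ((S ^^ n) a) ((S ^^ (n + k)) a) - 0) < r"
    using \<open>0 < r\<close> assms funpow_maps_to nonneg by (intro exI[of _ m]) fastforce
qed

lemma picard_inj:
  assumes "a \<in> E" and no_fix: "\<And>u. u \<in> E \<Longrightarrow> S u \<noteq> u"
  shows "inj (\<lambda>n. (S ^^ n) a)"
proof -
  have "strict_mono (\<lambda>n. - \<rho> ((S ^^ n) a) ((S ^^ Suc n) a))"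
    unfolding strict_mono_Suc_iff
  proof
    fix n
    have "(S ^^ n) a \<in> E" using assms(1) by (rule funpow_maps_to)
    then show "- \<rho> ((S ^^ n) a) ((S ^^ Suc n) a) < - \<rho> ((S ^^ Suc n) a) ((S ^^ Suc (Suc n)) a)"
      using strictly_contractive[OF _ maps_to] no_fix by fastforce
  qed
  then have "inj (\<lambda>n. - \<rho> ((S ^^ n) a) ((S ^^ Suc n) a))"
    by (rule strict_mono_imp_inj_on)
  \<comment> \<open>A point determines its distance to its image, so a repeated point would repeat a
    distance.\<close>
  then show ?thesis
    unfolding inj_on_def by (metis funpow.simps(2) comp_apply)
qed

lemma picard_cauchy:
  assumes a: "a \<in> E" and inj: "inj (\<lambda>n. (S ^^ n) a)"
  shows "cauchy_seq (\<lambda>n. (S ^^ n) a)"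
  unfolding cauchy_seq_def
proof (intro allI impI)
  fix e :: real assume "0 < e"
  \<comment> \<open>Halving leaves room to pass from a non-strict bound to the strict bound
    \<open>e\<close>.\<close>
  define \<epsilon> where "\<epsilon> = e / 2"
  define x where "x = (\<lambda>n. (S ^^ n) a)"
  have xE: "x n \<in> E" for n
    unfolding x_def using a by (rule funpow_maps_to)
  have \<epsilon>: "0 < \<epsilon>" "\<epsilon> < e" using \<open>0 < e\<close> by (auto simp: \<epsilon>_def)
  then have "0 < \<epsilon> / (2 * s)" using s_ge_1 by simp
  then obtain m0 where m0: "\<And>u w n. \<lbrakk>u \<in> E; w \<in> E; \<rho> u w \<le> \<epsilon>; m0 \<le> n\<rbrakk>
      \<Longrightarrow> \<rho> ((S ^^ n) u) ((S ^^ n) w) \<le> \<epsilon> / (2 * s)"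
    using funpow_uniformly_contracts by metis
  \<comment> \<open>Positivity of \<open>m\<close> keeps the polygon vertices, which start at index
    \<open>n + m\<close>, off \<open>x n\<close> and makes \<open>p - m\<close> smaller than
    \<open>p\<close>.\<close>
  define m where "m = Suc m0"
  have shift: "\<rho> (x (n + m)) (x (n + p + m)) \<le> \<epsilon> / (2 * s)" if "\<rho> (x n) (x (n + p)) \<le> \<epsilon>" for n p
    using m0[OF xE xE that, of m] by (simp add: m_def x_def funpow_add add.commute)
  \<comment> \<open>The polygon below has \<open>v\<close> edges of length at most \<eta>, in total
    \<open>\<epsilon> / (2 * s)\<close>; its last edge adds as much again, and the factor
    \<open>s\<close> restores \<epsilon>.\<close>
  define \<eta> where "\<eta> = \<epsilon> / (2 * s * real v)"
  have \<eta>: "0 < \<eta>" using \<epsilon> s_ge_1 v_pos by (simp add: \<eta>_def)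
  have \<eta>_le: "\<eta> \<le> \<epsilon>"
  proof -
    have "1 * 1 \<le> s * real v" using s_ge_1 v_pos by (intro mult_mono) auto
    then show ?thesis using \<epsilon> by (simp add: \<eta>_def field_simps)
  qed
  have "\<forall>\<^sub>F n in sequentially. \<rho> (x n) (x (n + k)) < \<eta>" for k
    using picard_dist_tendsto_0[OF a, of k] \<eta> unfolding x_def by (rule order_tendstoD)
  then have "\<forall>\<^sub>F n in sequentially. \<forall>k\<in>{..m + v}. \<rho> (x n) (x (n + k)) < \<eta>"
    by (simp add: eventually_ball_finite)
  then obtain N where N: "\<And>n k. \<lbrakk>N \<le> n; k \<le> m + v\<rbrakk> \<Longrightarrow> \<rho> (x n) (x (n + k)) < \<eta>"
    unfolding eventually_sequentially by auto
  have bound: "\<rho> (x n) (x (n + p)) \<le> \<epsilon>" if n: "N \<le> n" for n p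
  proof (induction p rule: less_induct)
    case (less p)
    show ?case
    proof (cases "p \<le> m + v")
      case True
      then show ?thesis using N[OF n, of p] \<eta>_le by linarith
    next
      case False
      \<comment> \<open>The vertices run backwards from \<open>x (n + m + v - 1)\<close> to
        \<open>x (n + m)\<close>, so that the last edge is the pair \<open>x n\<close>,
        \<open>x (n + (p - m))\<close> shifted by \<open>m\<close>.\<close>
      define z where "z = (\<lambda>i. x (n + m + v - i))"
      have xeq: "x i = x j \<longleftrightarrow> i = j" for i j
        using inj by (auto simp: x_def inj_def)
      have "inj_on z {1..v}"
        by (auto simp: inj_on_def z_def xeq)
      moreover have "z ` {1..v} \<subseteq> E - {x n, x (n + p)}"
        using False by (auto simp: z_def xeq xE m_def)
      ultimately have "\<rho> (x n) (x (n + p)) \<le>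
          s * (\<rho> (x n) (z 1) + (\<Sum>i = 1..<v. \<rho> (z i) (z (Suc i))) + \<rho> (z v) (x (n + p)))"
        using polygon[OF xE xE] by blast
      also have "\<dots> \<le> s * (\<eta> + real (v - 1) * \<eta> + \<epsilon> / (2 * s))"
      proof (intro mult_left_mono add_mono)
        show "\<rho> (x n) (z 1) \<le> \<eta>"
          using N[OF n, of "m + v - 1"] v_pos by (simp add: z_def add.assoc)
        have "\<rho> (z i) (z (Suc i)) \<le> \<eta>" if "i \<in> {1..<v}" for i
        proof -
          define k where "k = n + m + v - Suc i"
          have k: "N \<le> k" "n + m + v - i = k + 1"
            using that n by (auto simp: k_def)
          have "\<rho> (z i) (z (Suc i)) = \<rho> (x k) (x (k + 1))"
            using sym[OF xE xE] k(2) by (simp add: z_def flip: k_def)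
          then show ?thesis
            using N[OF k(1), of 1] by (simp add: m_def)
        qed
        then have "(\<Sum>i = 1..<v. \<rho> (z i) (z (Suc i))) \<le> (\<Sum>i = 1..<v. \<eta>)"
          by (rule sum_mono)
        then show "(\<Sum>i = 1..<v. \<rho> (z i) (z (Suc i))) \<le> real (v - 1) * \<eta>" by simp
        have "\<rho> (x n) (x (n + (p - m))) \<le> \<epsilon>"
          using False less[of "p - m"] by (simp add: m_def)
        then show "\<rho> (z v) (x (n + p)) \<le> \<epsilon> / (2 * s)"
          using shift[of n "p - m"] False by (simp add: z_def)
      qed (use s_ge_1 in simp)
      also have "\<dots> = s * (real v * \<eta> + \<epsilon> / (2 * s))"
        using v_pos by (simp add: of_nat_diff algebra_simps)
      also have "\<dots> = \<epsilon>"
        using s_ge_1 v_pos by (simp add: \<eta>_def field_simps)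
      finally show ?thesis .
    qed
  qed
  show "\<exists>n0. \<forall>n>n0. \<forall>p\<ge>1. \<rho> ((S ^^ n) a) ((S ^^ (n + p)) a) < e"
    using bound \<epsilon>(2) unfolding x_def by (intro exI[of _ N]) (meson le_less_trans less_imp_le)
qed

text \<open>As \<rho> may be discontinuous, the limit is not taken inside it: a polygon from
  \<open>u\<close> to \<open>S u\<close> has edges tending to 0, the last one joining images of
  \<open>x (n + (v - 1))\<close> and \<open>u\<close>.\<close>

lemma picard_limit_fixed:
  assumes a: "a \<in> E" and inj: "inj (\<lambda>n. (S ^^ n) a)"
    and u: "u \<in> E" and lim: "converges_to (\<lambda>n. (S ^^ n) a) u"
  shows "S u = u"
proof -
  define x where "x = (\<lambda>n. (S ^^ n) a)"
  have xE: "x n \<in> E" for n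
    unfolding x_def using a by (rule funpow_maps_to)
  have inj: "inj x" using inj by (simp add: x_def)
  have lim: "(\<lambda>n. \<rho> (x n) u) \<longlonglongrightarrow> 0"
    using lim by (simp add: converges_to_def x_def)
  \<comment> \<open>An injective sequence meets each point at most once, so late vertices differ
    from both endpoints.\<close>
  have avoid: "\<forall>\<^sub>F n in sequentially. x n \<noteq> c" for c
  proof -
    have "finite (x -` {c})" using inj by (intro finite_vimageI) auto
    then have "\<forall>\<^sub>F n in cofinite. x n \<noteq> c"
      by (simp add: eventually_cofinite vimage_def)
    then show ?thesis by (simp add: cofinite_eq_sequentially)
  qed
  have "\<forall>\<^sub>F n in sequentially. x n \<noteq> u \<and> x n \<noteq> S u"
    using avoid eventually_conj by blast
  then obtain M where M: "\<And>n. M \<le> n \<Longrightarrow> x n \<noteq> u \<and> x n \<noteq> S u"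
    unfolding eventually_sequentially by blast
  let ?B = "\<lambda>n. s * (\<rho> (x (n + 1)) u + (\<Sum>i = 1..<v. \<rho> (x (n + i)) (x (n + i + 1))) + \<rho> (x (n + (v - 1))) u)"
  have "\<rho> u (S u) \<le> ?B n" if n: "M \<le> n" for n
  proof -
    define z where "z = (\<lambda>i. x (n + i))"
    have "inj_on z {1..v}"
      using inj by (auto simp: z_def intro!: inj_onI dest: injD)
    moreover have "z ` {1..v} \<subseteq> E - {u, S u}"
      using M[OF trans_le_add1[OF n]] xE by (auto simp: z_def)
    ultimately have "\<rho> u (S u) \<le> s * (\<rho> u (z 1) + (\<Sum>i = 1..<v. \<rho> (z i) (z (Suc i))) + \<rho> (z v) (S u))"
      using polygon[OF u maps_to[OF u]] by blast
    also have "\<dots> \<le> ?B n"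
    proof (intro mult_left_mono add_mono)
      show "\<rho> u (z 1) \<le> \<rho> (x (n + 1)) u" using sym[OF u xE] by (simp add: z_def)
      have "z v = S (x (n + (v - 1)))"
        using v_pos by (cases v) (auto simp: z_def x_def)
      then show "\<rho> (z v) (S u) \<le> \<rho> (x (n + (v - 1))) u"
        using nonexpansive[OF xE u] by simp
    qed (use s_ge_1 in \<open>auto simp: z_def\<close>)
    finally show ?thesis .
  qed
  moreover have "?B \<longlonglongrightarrow> s * (0 + (\<Sum>i = 1..<v. 0) + 0)"
  proof (intro tendsto_intros tendsto_sum)
    show "(\<lambda>n. \<rho> (x (n + i)) (x (n + i + 1))) \<longlonglongrightarrow> 0" for i
      using LIMSEQ_ignore_initial_segment[OF picard_dist_tendsto_0[OF a, of 1], of i] by (simp add: x_def)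
  qed (use LIMSEQ_ignore_initial_segment[OF lim] in blast)+
  ultimately have "\<rho> u (S u) \<le> s * (0 + (\<Sum>i = 1..<v. 0) + 0)"
    by (intro LIMSEQ_le_const) auto
  then show ?thesis
    using nonneg[OF u maps_to[OF u]] zero_iff[OF u maps_to[OF u]] by simp
qed

end

theorem theorem1:
  fixes E :: "'a set" and \<rho> :: "'a \<Rightarrow> 'a \<Rightarrow> real" and v :: nat and s :: real and S :: "'a \<Rightarrow> 'a"
  assumes "complete_bv_metric_space E \<rho> v s"
    and "E \<noteq> {}"
    and "S \<in> E \<rightarrow> E"
    and "weakly_contractive E \<rho> S"
  shows "\<exists>!u. u \<in> E \<and> S u = u"
proof -
  interpret complete_bv_metric_space E \<rho> v s by fact
  obtain \<phi> where "weak_contraction E \<rho> v s S \<phi>"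
  proof -
    obtain \<phi> :: "real \<Rightarrow> real" where "\<phi> \<in> {0..} \<rightarrow> {0..}" "mono_on {0..} \<phi>" "\<forall>t\<ge>0. \<phi> t = 0 \<longleftrightarrow> t = 0"
      "\<forall>u\<in>E. \<forall>w\<in>E. \<rho> (S u) (S w) \<le> \<rho> u w - \<phi> (\<rho> u w)"
      using assms(4) unfolding weakly_contractive_def by blast
    then have "weak_contraction E \<rho> v s S \<phi>"
      using assms(3) by unfold_locales auto
    then show thesis by (rule that)
  qed
  then interpret weak_contraction E \<rho> v s S \<phi> .
  \<comment> \<open>Arguing by contradiction secures the injectivity of the orbit on which the
    polygons rely.\<close>
  have "\<exists>u\<in>E. S u = u"
  proof (rule ccontr)
    assume no_fix: "\<not> ?thesis"
    obtain a where a: "a \<in> E" using assms(2) by blast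
    have inj: "inj (\<lambda>n. (S ^^ n) a)" using a no_fix by (intro picard_inj) auto
    have "range (\<lambda>n. (S ^^ n) a) \<subseteq> E" using funpow_maps_to[OF a] by blast
    from complete[OF this picard_cauchy[OF a inj]] show False
      using picard_limit_fixed[OF a inj] no_fix by blast
  qed
  then show ?thesis using fixed_point_unique by blast
qed

end
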